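(* Let $V$ be a vector space of finite dimension $n$ over $\mathbb{F}_q$. Let $\mathcal{M}$ be an $\mathbb{F}_q$-subspace of $\mathrm{Bil}(V)$ of dimension $2n$ and suppose that the rank of each non-zero element of $\mathcal{M}$ is either $r$ or $n$, where $r$ is an integer with $0<r<n$. Suppose also that $q\geq r+1$. Then $n-r$ divides $n$ and the number of elements of rank $r$ in $\mathcal{M}$ is \[ \frac{(q^n-1)^2}{q^{n-r}-1}. \]
   Context: $q$ is a power of a prime and $\mathbb{F}_q$ is the field of order $q$. $\mathrm{Bil}(V)$ denotes the $\mathbb{F}_q$-vector space of all bilinear forms $f:V\times V\to\mathbb{F}_q$. The left radical of $f$ is $\mathrm{rad}_L f=\{u\in V: f(u,v)=0 \text{ for all } v\in V\}$, and the rank of $f$ is $\mathrm{rank} f=\dim V-\dim \mathrm{rad}_L f$. *)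

theory Defs
  imports Complex_Main "HOL-Library.Function_Algebras" "HOL-Library.Cardinality"
begin

text \<open>Addition of forms is the pointwise addition of functions provided by
  \<^theory>\<open>HOL-Library.Function_Algebras\<close>; the following scalar multiplication goes with it.\<close>

definition form_scale :: "'a::field \<Rightarrow> ('v \<Rightarrow> 'v \<Rightarrow> 'a) \<Rightarrow> 'v \<Rightarrow> 'v \<Rightarrow> 'a" where
  "form_scale c f = (\<lambda>u v. c * f u v)"

lemma vector_space_form_scale: "vector_space (form_scale :: 'a::field \<Rightarrow> ('v \<Rightarrow> 'v \<Rightarrow> 'a) \<Rightarrow> _)"
  by unfold_locales (auto simp: form_scale_def fun_eq_iff algebra_simps)

text \<open>The space \<open>V\<close> is the whole type \<open>'v\<close>, with scalar multiplication \<open>scale\<close>.\<close>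

definition Bil :: "('a::field \<Rightarrow> 'v::ab_group_add \<Rightarrow> 'v) \<Rightarrow> ('v \<Rightarrow> 'v \<Rightarrow> 'a) set" where
  "Bil scale = {f. (\<forall>u. Vector_Spaces.linear scale (*) (\<lambda>v. f u v)) \<and>
                   (\<forall>v. Vector_Spaces.linear scale (*) (\<lambda>u. f u v))}"

definition left_radical :: "('v \<Rightarrow> 'v \<Rightarrow> 'a::zero) \<Rightarrow> 'v set" where
  "left_radical f = {u. \<forall>v. f u v = 0}"

definition form_rank ::
    "('a::field \<Rightarrow> 'v::ab_group_add \<Rightarrow> 'v) \<Rightarrow> ('v \<Rightarrow> 'v \<Rightarrow> 'a) \<Rightarrow> nat" where
  "form_rank scale f =
     vector_space.dim scale (UNIV :: 'v set) - vector_space.dim scale (left_radical f)"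

lemma subspace_Bil:
  fixes scale :: "'a::field \<Rightarrow> 'v::ab_group_add \<Rightarrow> 'v"
  assumes "vector_space scale"
  shows "module.subspace form_scale (Bil scale)"
proof -
  interpret V: vector_space scale by fact
  interpret F: vector_space "form_scale :: 'a \<Rightarrow> ('v \<Rightarrow> 'v \<Rightarrow> 'a) \<Rightarrow> _"
    by (rule vector_space_form_scale)
  have "vector_space ((*) :: 'a \<Rightarrow> 'a \<Rightarrow> 'a)"
    by unfold_locales (simp_all add: algebra_simps)
  then show ?thesis
    unfolding F.subspace_def Bil_def Vector_Spaces.linear_iff
    by (auto simp: form_scale_def algebra_simps V.vector_space_axioms)
qed

lemma subspace_left_radical:
  fixes scale :: "'a::field \<Rightarrow> 'v::ab_group_add \<Rightarrow> 'v"
  assumes "f \<in> Bil scale"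
  shows "module.subspace scale (left_radical f)"
proof -
  have lin: "Vector_Spaces.linear scale (*) (\<lambda>u. f u v)" for v
    using assms by (auto simp: Bil_def)
  interpret V: vector_space scale
    using lin by (simp add: Vector_Spaces.linear_iff)
  have add: "f (x + y) v = f x v + f y v" and mul: "f (scale c x) v = c * f x v" for x y c v
    using lin[of v] by (simp_all add: Vector_Spaces.linear_iff)
  have "f 0 v = 0" for v using mul[of 0 0 v] by simp
  then show ?thesis
    unfolding V.subspace_def left_radical_def by (simp add: add mul)
qed

end

theory Submission
  imports Defs "HOL-Library.FuncSet"
begin

text \<open>For \<open>u \<in> V\<close> let \<open>M u\<close> be the space of those \<open>f \<in> M\<close> whose left radical contains \<open>u\<close>. It is
  the kernel of the map \<open>f \<mapsto> f u\<close> from \<open>M\<close> to the dual of \<open>V\<close>, so it has at least \<open>q ^ n\<close>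
  elements. If \<open>u \<noteq> 0\<close>, no element of \<open>M u\<close> has rank \<open>n\<close>, hence all its nonzero elements have
  rank \<open>r\<close>. A space of forms of constant rank \<open>r < q\<close> has at most \<open>q ^ n\<close> elements
  (\<open>card_constant_rank_le\<close>), so \<open>M u\<close> has exactly \<open>q ^ n\<close> elements for every \<open>u \<noteq> 0\<close>. Counting
  the pairs \<open>(u, f)\<close> of a nonzero vector and a nonzero form with \<open>u\<close> in the left radical of \<open>f\<close>
  in both ways (\<open>sum_card_annihilators\<close>) then gives
  \<open>(q ^ n - 1)\<^sup>2 = k * (q ^ (n - r) - 1)\<close> for the number \<open>k\<close> of forms of rank \<open>r\<close>. So
  \<open>q ^ (n - r) - 1\<close> divides \<open>(q ^ n - 1)\<^sup>2\<close>, which by an argument on greatest common divisors is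
  possible only if \<open>n - r\<close> divides \<open>n\<close> (\<open>dvd_if_power_minus_one_dvd_square\<close>).

  The bound for a constant rank space \<open>N\<close> rests on one fact: if \<open>f, g \<in> N\<close> and \<open>f \<noteq> 0\<close>, then
  \<open>g\<close> vanishes on the product of the left and the right radical of \<open>f\<close>
  (\<open>vanishes_on_radicals_of_pencil\<close>). Otherwise each of the \<open>q\<close> forms \<open>g + t f\<close> would have a
  nonzero radical vector in one and the same space of dimension \<open>r\<close>. These vectors behave like
  eigenvectors for distinct eigenvalues, hence are independent, against \<open>q > r\<close>. This is where the
  size of the field enters.

  Suppose now that \<open>N\<close> has more than \<open>q ^ n\<close> elements. Then every vector \<open>u\<close> is in the left
  radical of some nonzero \<open>f \<in> N\<close>, so the functionals \<open>g u\<close> for \<open>g \<in> N\<close> all vanish on the right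
  radical of \<open>f\<close>. There are at most \<open>q ^ r\<close> such functionals, and therefore at least
  \<open>card N / q ^ r\<close> elements of \<open>N\<close> have \<open>u\<close> in their left radical. This exceeds what the same
  double count, applied to \<open>N\<close>, allows.

  The argument is carried out with cardinalities of finite subspaces instead of dimensions:
  kernels, images and complements then combine by multiplication, and no bases of spaces of forms
  have to be chosen.\<close>

section \<open>Cardinalities in vector spaces over a finite field\<close>

lemma card_eq_card_kernel_mult_card_image:
  fixes \<phi> :: "'b::ab_group_add \<Rightarrow> 'c::ab_group_add"
  assumes fin: "finite A"
    and diff: "\<And>x y. x \<in> A \<Longrightarrow> y \<in> A \<Longrightarrow> x - y \<in> A"
    and hom: "\<And>x y. x \<in> A \<Longrightarrow> y \<in> A \<Longrightarrow> \<phi> (x - y) = \<phi> x - \<phi> y"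
  shows "card A = card {x \<in> A. \<phi> x = 0} * card (\<phi> ` A)"
proof -
  have add: "x + y \<in> A" if "x \<in> A" "y \<in> A" for x y
    using diff[OF that(1) diff[OF diff[OF that(2) that(2)] that(2)]] by simp
  have fibre: "card {x \<in> A. \<phi> x = b} = card {x \<in> A. \<phi> x = 0}" if "b \<in> \<phi> ` A" for b
  proof -
    obtain a where a: "a \<in> A" "b = \<phi> a" using \<open>b \<in> \<phi> ` A\<close> by auto
    have image: "(\<lambda>x. x - a) ` {x \<in> A. \<phi> x = b} = {x \<in> A. \<phi> x = 0}"
    proof (intro set_eqI iffI)
      fix y assume "y \<in> (\<lambda>x. x - a) ` {x \<in> A. \<phi> x = b}"
      then show "y \<in> {x \<in> A. \<phi> x = 0}" using a diff hom by auto
    next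
      fix y assume "y \<in> {x \<in> A. \<phi> x = 0}"
      then have y: "y \<in> A" "\<phi> y = 0" by auto
      have "\<phi> (y + a) = b" using hom[OF add[OF y(1) a(1)] a(1)] y(2) a(2) by simp
      then show "y \<in> (\<lambda>x. x - a) ` {x \<in> A. \<phi> x = b}"
        using add[OF y(1) a(1)] by (intro image_eqI[of _ _ "y + a"]) auto
    qed
    have "inj_on (\<lambda>x. x - a) {x \<in> A. \<phi> x = b}" by (auto intro: inj_onI)
    then show ?thesis using card_image[of "\<lambda>x. x - a" "{x \<in> A. \<phi> x = b}"] image by simp
  qed
  have "card A = (\<Sum>x\<in>A. 1)" by simp
  also have "\<dots> = (\<Sum>b\<in>\<phi> ` A. \<Sum>x\<in>{x \<in> A. \<phi> x = b}. 1)"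
    using fin by (rule sum.image_gen)
  also have "\<dots> = (\<Sum>b\<in>\<phi> ` A. card {x \<in> A. \<phi> x = 0})" using fibre by (intro sum.cong) auto
  finally show ?thesis by simp
qed

locale finite_field_space = vector_space scale
  for scale :: "'a::{field,finite} \<Rightarrow> 'b::ab_group_add \<Rightarrow> 'b"  (infixr \<open>*s\<close> 75)
begin

lemma card_eq_power_card_basis:
  assumes fin: "finite B" and ind: "independent B"
  shows "card (span B) = CARD('a) ^ card B"
proof -
  let ?h = "\<lambda>c. \<Sum>b\<in>B. c b *s b"
  have "inj_on ?h (B \<rightarrow>\<^sub>E UNIV)"
  proof (rule inj_onI)
    fix c d assume c: "c \<in> B \<rightarrow>\<^sub>E UNIV" and d: "d \<in> B \<rightarrow>\<^sub>E UNIV" and "?h c = ?h d"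
    then have "(\<Sum>b\<in>B. (c b - d b) *s b) = 0"
      by (simp add: scale_left_diff_distrib sum_subtractf)
    then have "c b = d b" if "b \<in> B" for b
      using independentD[OF ind fin order_refl _ that, of "\<lambda>b. c b - d b"] by simp
    then show "c = d" using c d by (auto intro: PiE_ext)
  qed
  moreover have "?h ` (B \<rightarrow>\<^sub>E UNIV) = span B"
  proof -
    have "?h c = ?h (restrict c B)" for c by (intro sum.cong) auto
    then have "?h ` (B \<rightarrow>\<^sub>E UNIV) = range ?h"
      by (auto intro!: image_eqI[of _ ?h "restrict _ B"])
    then show ?thesis using span_finite[OF fin] by simp
  qed
  ultimately have "card (span B) = card (B \<rightarrow>\<^sub>E (UNIV :: 'a set))"
    using card_image[of ?h "B \<rightarrow>\<^sub>E UNIV"] by simp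
  then show ?thesis using fin by (simp add: card_funcsetE)
qed

lemma card_subspace:
  assumes S: "subspace S" and fin: "finite S"
  shows "card S = CARD('a) ^ dim S"
proof -
  obtain B where B: "B \<subseteq> S" "independent B" "S \<subseteq> span B" "card B = dim S"
    by (rule basis_exists)
  have "span B = S" using B S by (simp add: span_subspace)
  then show ?thesis using card_eq_power_card_basis[OF finite_subset[OF B(1) fin] B(2)] B(4) by simp
qed

lemma finite_span:
  assumes "finite S"
  shows "finite (span S)"
  using assms
proof (induction S rule: finite_induct)
  case (insert a S)
  have "span (insert a S) \<subseteq> (\<lambda>(k, y). k *s a + y) ` (UNIV \<times> span S)"
  proof
    fix x assume "x \<in> span (insert a S)"
    then obtain k where "x - k *s a \<in> span S" by (auto simp: span_insert)
    then show "x \<in> (\<lambda>(k, y). k *s a + y) ` (UNIV \<times> span S)"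
      by (intro image_eqI[of _ _ "(k, x - k *s a)"]) auto
  qed
  with insert.IH show ?case by (meson finite finite_SigmaI finite_imageI finite_subset)
qed simp

text \<open>This is the bound on the dimension of a direct sum: addition is injective on \<open>A \<times> B\<close>.\<close>

lemma card_mult_le_if_Int_trivial:
  assumes A: "subspace A" "A \<subseteq> W" and B: "subspace B" "B \<subseteq> W" and W: "subspace W" "finite W"
    and triv: "A \<inter> B \<subseteq> {0}"
  shows "card A * card B \<le> card W"
proof -
  have "inj_on (\<lambda>(x, y). x + y) (A \<times> B)"
  proof (rule inj_onI, clarsimp)
    fix x y x' y' assume h: "x \<in> A" "y \<in> B" "x' \<in> A" "y' \<in> B" "x + y = x' + y'"
    then have e: "x - x' = y' - y" by (simp add: algebra_simps)
    have "x - x' \<in> A" "y' - y \<in> B" using h A B by (auto intro: subspace_diff)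
    then have "x - x' \<in> A \<inter> B" using e by simp
    then have "x - x' = 0" using triv by blast
    then show "x = x' \<and> y = y'" using e by simp
  qed
  moreover have "(\<lambda>(x, y). x + y) ` (A \<times> B) \<subseteq> W"
    using A B W by (auto intro: subspace_add)
  ultimately have "card (A \<times> B) \<le> card W" using W(2) by (rule card_inj_on_le)
  then show ?thesis by (simp add: card_cartesian_product)
qed

text \<open>A basis \<open>B\<close> of \<open>A\<close> extends to a basis \<open>D\<close> of \<open>W\<close>, and the new vectors \<open>D - B\<close> span a complement.\<close>

lemma exists_complement:
  assumes A: "subspace A" "A \<subseteq> W" and W: "subspace W" "finite W"
  obtains C where "subspace C" "C \<subseteq> W" "A \<inter> C \<subseteq> {0}" "card A * card C = card W"
proof -
  obtain B where B: "B \<subseteq> A" "independent B" "A \<subseteq> span B"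
    using basis_exists[of A] by metis
  obtain D where D: "B \<subseteq> D" "D \<subseteq> W" "independent D" "W \<subseteq> span D"
    using maximal_independent_subset_extend[OF subset_trans[OF B(1) A(2)] B(2)] by metis
  have finD: "finite D" using D W by (meson finite_subset)
  let ?C = "span (D - B)"
  have spA: "span B = A" using B(1,3) A(1) by (rule span_subspace)
  have spW: "span D = W" using D(2,4) W(1) by (rule span_subspace)
  have CW: "?C \<subseteq> W" using spW span_mono[of "D - B" D] by blast
  have triv: "A \<inter> ?C \<subseteq> {0}"
  proof
    fix x assume "x \<in> A \<inter> ?C"
    then have "x \<in> span B" "x \<in> ?C" using spA by auto
    moreover have fB: "finite B" using finD D by (meson finite_subset)
    ultimately have xB: "x \<in> range (\<lambda>c. \<Sum>b\<in>B. c b *s b)"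
      and xC: "x \<in> range (\<lambda>d. \<Sum>b\<in>D - B. d b *s b)"
      using finD by (simp_all add: span_finite)
    obtain c where c: "x = (\<Sum>b\<in>B. c b *s b)" using xB by (rule rangeE)
    obtain d where d: "x = (\<Sum>b\<in>D - B. d b *s b)" using xC by (rule rangeE)
    let ?e = "\<lambda>b. if b \<in> B then c b else - d b"
    have "(\<Sum>b\<in>D. ?e b *s b) = (\<Sum>b\<in>D - B. ?e b *s b) + (\<Sum>b\<in>B. ?e b *s b)"
      using D(1) finD by (rule sum.subset_diff)
    also have "(\<Sum>b\<in>B. ?e b *s b) = x" unfolding c by (intro sum.cong) auto
    also have "(\<Sum>b\<in>D - B. ?e b *s b) = - x"
      unfolding d sum_negf[symmetric] by (intro sum.cong) auto
    finally have "(\<Sum>b\<in>D. ?e b *s b) = 0" by simp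
    then have "c b = 0" if "b \<in> B" for b
      using independentD[OF D(3) finD order_refl, of ?e b] that D(1) by auto
    then show "x \<in> {0}" using c by simp
  qed
  have "card A * card ?C = CARD('a) ^ (card B + card (D - B))"
    using card_eq_power_card_basis[of B] card_eq_power_card_basis[of "D - B"] B D finD spA
    by (metis Diff_subset finite_Diff finite_subset independent_mono power_add)
  also have "card B + card (D - B) = card D"
    using D finD by (metis card_Diff_subset card_mono finite_subset le_add_diff_inverse)
  also have "CARD('a) ^ card D = card W" using card_eq_power_card_basis[OF finD D(3)] spW by simp
  finally show ?thesis using that[OF subspace_span CW triv] by simp
qed

end

lemma finite_field_space_form_scale:
  "finite_field_space (form_scale :: 'a::{field,finite} \<Rightarrow> ('v \<Rightarrow> 'v \<Rightarrow> 'a) \<Rightarrow> _)"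
  using vector_space_form_scale by (simp add: finite_field_space_def)

section \<open>Forms and their radicals\<close>

definition right_radical :: "('v \<Rightarrow> 'v \<Rightarrow> 'a::zero) \<Rightarrow> 'v set" where
  "right_radical f = {w. \<forall>v. f v w = 0}"

locale finite_vector_space = finite_field_space scale
  for scale :: "'a::{field,finite} \<Rightarrow> 'v::ab_group_add \<Rightarrow> 'v"  (infixr \<open>*s\<close> 75) +
  assumes finite_UNIV: "finite (UNIV :: 'v set)"
begin

sublocale F: finite_field_space "form_scale :: 'a \<Rightarrow> ('v \<Rightarrow> 'v \<Rightarrow> 'a) \<Rightarrow> _"
  by (rule finite_field_space_form_scale)

lemma finite_vectors [simp]: "finite (S :: 'v set)"
  using finite_UNIV by (meson finite_subset subset_UNIV)

lemma finite_functionals [simp]: "finite (S :: ('v \<Rightarrow> 'a) set)"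
proof -
  have "finite (UNIV :: ('v \<Rightarrow> 'a) set)" by (simp add: finite_UNIV_fun)
  then show ?thesis by (meson finite_subset subset_UNIV)
qed

lemma finite_forms [simp]: "finite (S :: ('v \<Rightarrow> 'v \<Rightarrow> 'a) set)"
proof -
  have "finite (UNIV :: ('v \<Rightarrow> 'v \<Rightarrow> 'a) set)" by (simp add: finite_UNIV_fun)
  then show ?thesis by (meson finite_subset subset_UNIV)
qed

lemma Bil_rules:
  assumes "f \<in> Bil scale"
  shows "f (x + y) v = f x v + f y v" "f v (x + y) = f v x + f v y"
    "f (c *s x) v = c * f x v" "f v (c *s x) = c * f v x"
    "f 0 v = 0" "f v 0 = 0" "f (x - y) v = f x v - f y v" "f v (x - y) = f v x - f v y"
proof -
  have l: "Vector_Spaces.linear scale (*) (\<lambda>u. f u v)" and r: "Vector_Spaces.linear scale (*) (f v)"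
    for v using assms by (auto simp: Bil_def)
  interpret L: Vector_Spaces.linear scale "(*)" "\<lambda>u. f u v" by (rule l)
  interpret R: Vector_Spaces.linear scale "(*)" "f v" by (rule r)
  show "f (x + y) v = f x v + f y v" "f v (x + y) = f v x + f v y"
    "f (c *s x) v = c * f x v" "f v (c *s x) = c * f v x"
    "f 0 v = 0" "f v 0 = 0" "f (x - y) v = f x v - f y v" "f v (x - y) = f v x - f v y"
    using L.add L.scale L.zero L.diff R.add R.scale R.zero R.diff by auto
qed

lemma Bil_sum_left:
  assumes "f \<in> Bil scale"
  shows "f (\<Sum>i\<in>I. c i *s x i) v = (\<Sum>i\<in>I. c i * f (x i) v)"
  by (induction I rule: infinite_finite_induct) (simp_all add: Bil_rules[OF assms])

lemma subspace_right_radical: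
  assumes "f \<in> Bil scale"
  shows "subspace (right_radical f)"
  by (simp add: subspace_def right_radical_def Bil_rules[OF assms])

text \<open>A functional that vanishes on \<open>R\<close> is determined by its values on the vectors that extend a basis of
  \<open>R\<close> to a basis of the whole space. With \<open>R = {0}\<close> this bounds the size of the dual space.\<close>

lemma card_functionals_vanishing_on:
  fixes E :: "('v \<Rightarrow> 'a) set"
  assumes R: "subspace R"
    and lin: "\<And>\<phi>. \<phi> \<in> E \<Longrightarrow> Vector_Spaces.linear scale (*) \<phi>"
    and van: "\<And>\<phi> x. \<phi> \<in> E \<Longrightarrow> x \<in> R \<Longrightarrow> \<phi> x = 0"
  shows "card E * card R \<le> card (UNIV :: 'v set)"
proof -
  obtain B where B: "B \<subseteq> R" "independent B" "R \<subseteq> span B"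
    using basis_exists[of R] by metis
  obtain D where D: "B \<subseteq> D" "independent D" "UNIV \<subseteq> span D"
    using maximal_independent_subset_extend[OF subset_UNIV B(2)] by metis
  have "inj_on (\<lambda>\<phi>. restrict \<phi> (D - B)) E"
  proof (rule inj_onI)
    fix \<phi> \<psi> assume h: "\<phi> \<in> E" "\<psi> \<in> E" "restrict \<phi> (D - B) = restrict \<psi> (D - B)"
    interpret P: Vector_Spaces.linear scale "(*)" \<phi> by (rule lin) fact
    interpret Q: Vector_Spaces.linear scale "(*)" \<psi> by (rule lin) fact
    have "\<phi> x = \<psi> x" if "x \<in> D" for x
    proof (cases "x \<in> B")
      case True
      then show ?thesis using van h B by (metis subsetD)
    next
      case False
      then show ?thesis using h(3) that by (metis DiffI restrict_apply')
    qed
    moreover have "subspace {x. \<phi> x = \<psi> x}"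
      by (simp add: subspace_def P.add Q.add P.scale Q.scale P.zero Q.zero)
    ultimately have "span D \<subseteq> {x. \<phi> x = \<psi> x}" by (intro span_minimal) auto
    then show "\<phi> = \<psi>" using D(3) by auto
  qed
  moreover have "(\<lambda>\<phi>. restrict \<phi> (D - B)) ` E \<subseteq> (D - B) \<rightarrow>\<^sub>E (UNIV :: 'a set)"
    by (intro image_subsetI) (simp only: restrict_PiE_iff UNIV_I ball_triv simp_thms)
  ultimately have "card E \<le> card ((D - B) \<rightarrow>\<^sub>E (UNIV :: 'a set))"
    by (rule card_inj_on_le) (simp add: finite_PiE)
  then have "card E \<le> CARD('a) ^ card (D - B)" by (simp add: card_funcsetE)
  then have "card E * card R \<le> CARD('a) ^ card (D - B) * CARD('a) ^ card B"
    using card_eq_power_card_basis[of B] span_subspace[OF B(1,3) R] B(2) by simp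
  also have "\<dots> = CARD('a) ^ card D"
    using D(1) by (simp add: power_add[symmetric] card_Diff_subset card_mono)
  also have "\<dots> = card (UNIV :: 'v set)"
    using card_eq_power_card_basis[OF _ D(2)] equalityI[OF subset_UNIV D(3)] by simp
  finally show ?thesis .
qed

text \<open>Row rank against column rank. The map \<open>w \<mapsto> f(_, w)\<close> has the right radical as its kernel, and its
  image consists of functionals vanishing on the left radical, so that the image is small if the
  left radical is large.\<close>

lemma card_left_radical_le_card_right_radical:
  assumes f: "f \<in> Bil scale"
  shows "card (left_radical f) \<le> card (right_radical f)"
proof -
  let ?\<Phi> = "\<lambda>w u. f u w"
  have "{w \<in> UNIV. ?\<Phi> w = 0} = right_radical f" by (auto simp: right_radical_def fun_eq_iff)
  moreover have "card (UNIV :: 'v set) = card {w \<in> UNIV. ?\<Phi> w = 0} * card (range ?\<Phi>)"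
    by (rule card_eq_card_kernel_mult_card_image) (auto simp: fun_eq_iff Bil_rules[OF f])
  moreover have "card (range ?\<Phi>) * card (left_radical f) \<le> card (UNIV :: 'v set)"
    using f by (intro card_functionals_vanishing_on subspace_left_radical)
      (auto simp: Bil_def left_radical_def)
  ultimately have "card (range ?\<Phi>) * card (left_radical f) \<le> card (range ?\<Phi>) * card (right_radical f)"
    by (simp add: mult.commute)
  moreover have "card (range ?\<Phi>) > 0" by (simp add: card_gt_0_iff)
  ultimately show ?thesis by simp
qed

section \<open>Pencils of bilinear forms\<close>

text \<open>The usual proof that eigenvectors for distinct eigenvalues are independent, in a setting without
  an endomorphism. On \<open>P\<close> the form \<open>f\<close> has trivial left radical, so \<open>g(x, _) = - t f(x, _)\<close> says that
  \<open>x\<close> is an eigenvector, with eigenvalue \<open>t\<close>, of the partially defined map taking \<open>x\<close> to the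
  \<open>y \<in> P\<close> with \<open>f(y, _) = - g(x, _)\<close>. Applying this map to a linear relation multiplies each
  coefficient by its eigenvalue.\<close>

lemma pencil_eigenvectors_independent:
  assumes f: "f \<in> Bil scale" and g: "g \<in> Bil scale"
    and P: "subspace P" "P \<inter> left_radical f \<subseteq> {0}"
    and x: "\<And>t. x t \<in> P" "\<And>t. x t \<noteq> 0" "\<And>t v. g (x t) v + t * f (x t) v = 0"
    and fin: "finite T"
  shows "(\<Sum>t\<in>T. c t *s x t) = 0 \<Longrightarrow> t \<in> T \<Longrightarrow> c t = 0"
  using fin
proof (induction T arbitrary: c t rule: finite_induct)
  case (insert s T)
  let ?y = "\<Sum>t\<in>insert s T. (t * c t) *s x t"
  have "f ?y v = 0" for v
  proof -
    have "f ?y v = (\<Sum>t\<in>insert s T. (t * c t) * f (x t) v)" by (rule Bil_sum_left[OF f])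
    moreover have "g (\<Sum>t\<in>insert s T. c t *s x t) v = (\<Sum>t\<in>insert s T. c t * g (x t) v)"
      by (rule Bil_sum_left[OF g])
    then have "(\<Sum>t\<in>insert s T. c t * g (x t) v) = 0"
      unfolding insert.prems(1) by (simp only: Bil_rules(5)[OF g])
    moreover have "(t * c t) * f (x t) v + c t * g (x t) v = 0" for t
    proof -
      have "(t * c t) * f (x t) v + c t * g (x t) v = c t * (g (x t) v + t * f (x t) v)"
        by (simp only: distrib_left ac_simps)
      then show ?thesis by (simp only: x(3) mult_zero_right)
    qed
    then have "(\<Sum>t\<in>insert s T. (t * c t) * f (x t) v) + (\<Sum>t\<in>insert s T. c t * g (x t) v) = 0"
      by (simp only: sum.distrib[symmetric] sum.neutral_const)
    ultimately show ?thesis by (simp only: add_0_right)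
  qed
  moreover have "?y \<in> P" using P(1) x(1) by (intro subspace_sum subspace_scale)
  ultimately have y: "?y = 0" using P(2) by (auto simp: left_radical_def)
  \<comment> \<open>Subtracting \<open>s\<close> times the original relation eliminates \<open>x s\<close>.\<close>
  have "(\<Sum>t\<in>T. ((t - s) * c t) *s x t) = ?y - s *s (\<Sum>t\<in>insert s T. c t *s x t)"
    using insert.hyps
    by (simp add: scale_sum_right scale_right_distrib left_diff_distrib scale_left_diff_distrib
        sum_subtractf)
  then have "(\<Sum>t\<in>T. ((t - s) * c t) *s x t) = 0" using y insert.prems(1) by simp
  from insert.IH[OF this] have "(t - s) * c t = 0" if "t \<in> T" for t using that by blast
  then have T: "c t = 0" if "t \<in> T" for t using that insert.hyps(2) by auto
  then have "c s *s x s = 0" using insert.prems(1) insert.hyps by simp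
  then have "c s = 0" using x(2) by simp
  then show ?case using T insert.prems(2) by auto
qed simp

text \<open>Suppose \<open>g u w \<noteq> 0\<close>, and let \<open>H\<close> be the hyperplane of all \<open>x\<close> with \<open>g x w = 0\<close> and \<open>L\<close> the left
  radical of \<open>f\<close>. As \<open>w\<close> is in the right radical of \<open>f\<close>, the left radical of every \<open>g + t f\<close> lies
  in \<open>H\<close>, and it is larger than \<open>L \<inter> H\<close>, which does not contain \<open>u\<close>. So it meets any complement
  \<open>P\<close> of \<open>L \<inter> H\<close> in \<open>H\<close> nontrivially. This gives one eigenvector in \<open>P\<close> for each field element \<open>t\<close>.
  Their independence makes \<open>P\<close> of dimension at least \<open>q\<close>, whereas \<open>P\<close> meets \<open>L\<close> trivially and so has
  dimension at most the rank of \<open>f\<close>. In terms of ranks, the hypothesis \<open>pencil\<close> says that no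
  \<open>g + t f\<close> has larger rank than \<open>f\<close>, and \<open>large\<close> that the rank of \<open>f\<close> is smaller than \<open>q\<close>.\<close>

lemma vanishes_on_radicals_of_pencil:
  assumes f: "f \<in> Bil scale" and g: "g \<in> Bil scale"
    and pencil: "\<And>t. card (left_radical f) \<le> card (left_radical (g + form_scale t f))"
    and large: "card (UNIV :: 'v set) < CARD('a) ^ CARD('a) * card (left_radical f)"
    and u: "u \<in> left_radical f" and w: "w \<in> right_radical f"
  shows "g u w = 0"
proof (rule ccontr)
  assume nz: "g u w \<noteq> 0"
  let ?L = "left_radical f" and ?H = "{x. g x w = 0}"
  have L: "subspace ?L" using f by (rule subspace_left_radical)
  have H: "subspace ?H" by (simp add: subspace_def Bil_rules[OF g])
  have "subspace (?L \<inter> ?H)" using L H by (rule subspace_inter)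
  then obtain P where P: "subspace P" "P \<subseteq> ?H" "(?L \<inter> ?H) \<inter> P \<subseteq> {0}"
      and cP: "card (?L \<inter> ?H) * card P = card ?H"
    using exists_complement[of "?L \<inter> ?H" ?H] H by auto
  have PL: "P \<inter> ?L \<subseteq> {0}" using P by blast
  have "\<exists>x. x \<in> P \<and> x \<noteq> 0 \<and> (\<forall>v. g x v + t * f x v = 0)" for t
  proof (rule ccontr)
    let ?R = "left_radical (g + form_scale t f)"
    assume "\<not> ?thesis"
    then have "P \<inter> ?R \<subseteq> {0}" by (auto simp: left_radical_def form_scale_def)
    moreover have "g + form_scale t f \<in> Bil scale"
      using subspace_Bil[OF vector_space_axioms] f g by (intro F.subspace_add F.subspace_scale)
    then have "subspace ?R" by (rule subspace_left_radical)
    moreover have "?R \<subseteq> ?H"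
    proof
      fix x assume "x \<in> ?R"
      then have "g x w + t * f x w = 0" by (simp add: left_radical_def form_scale_def)
      then show "x \<in> ?H" using w by (simp add: right_radical_def)
    qed
    ultimately have "card P * card ?R \<le> card ?H"
      using P H by (intro card_mult_le_if_Int_trivial) auto
    also have "\<dots> = card P * card (?L \<inter> ?H)" using cP by (simp only: mult.commute)
    finally have "card ?R \<le> card (?L \<inter> ?H)"
      using P(1) subspace_0 by (auto simp: card_gt_0_iff)
    also have "\<dots> < card ?L" using u nz by (intro psubset_card_mono) auto
    finally show False using pencil[of t] by simp
  qed
  then obtain x where x: "\<And>t. x t \<in> P" "\<And>t. x t \<noteq> 0" "\<And>t v. g (x t) v + t * f (x t) v = 0"
    by metis
  let ?h = "\<lambda>c. \<Sum>t\<in>UNIV. c t *s x t"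
  have "inj ?h"
  proof (rule injI)
    fix c d assume "?h c = ?h d"
    then have "(\<Sum>t\<in>UNIV. (c t - d t) *s x t) = 0"
      by (simp add: scale_left_diff_distrib sum_subtractf)
    then have "c t - d t = 0" for t
      using pencil_eigenvectors_independent[OF f g P(1) PL x, of UNIV "\<lambda>t. c t - d t" t] by simp
    then show "c = d" by (simp add: fun_eq_iff)
  qed
  moreover have "range ?h \<subseteq> P" using P(1) x(1) by (auto intro!: subspace_sum subspace_scale)
  ultimately have "CARD('a \<Rightarrow> 'a) \<le> card P" by (intro card_inj_on_le) auto
  then have "CARD('a) ^ CARD('a) * card ?L \<le> card P * card ?L" by (simp add: card_fun)
  also have "\<dots> \<le> card (UNIV :: 'v set)"
    using P(1) L PL by (intro card_mult_le_if_Int_trivial) auto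
  finally show False using large by simp
qed

section \<open>Constant rank spaces\<close>

text \<open>Both sides count the pairs \<open>(u, f)\<close> of a nonzero vector and a nonzero form with \<open>u\<close> in the left
  radical of \<open>f\<close>, once by vectors and once by forms. The subtracted units remove \<open>f = 0\<close> and
  \<open>u = 0\<close>.\<close>

lemma sum_card_annihilators:
  assumes M: "F.subspace M" "M \<subseteq> Bil scale"
  shows "(\<Sum>u\<in>UNIV - {0}. card {f \<in> M. f u = 0} - 1) = (\<Sum>f\<in>M - {0}. card (left_radical f) - 1)"
proof -
  have "card {f \<in> M. f u = 0} - 1 = card {f \<in> M - {0}. f u = 0}" for u
  proof -
    have "{f \<in> M - {0}. f u = 0} = {f \<in> M. f u = 0} - {0}" by auto
    moreover have "0 \<in> {f \<in> M. f u = 0}" using F.subspace_0[OF M(1)] by simp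
    ultimately show ?thesis by (simp add: card_Diff_singleton)
  qed
  moreover have "card (left_radical f) - 1 = card {u \<in> UNIV - {0}. f u = 0}" if "f \<in> M - {0}" for f
  proof -
    have "{u \<in> UNIV - {0}. f u = 0} = left_radical f - {0}" by (auto simp: left_radical_def fun_eq_iff)
    moreover have "0 \<in> left_radical f" using that M by (auto simp: left_radical_def Bil_rules)
    ultimately show ?thesis by (simp add: card_Diff_singleton)
  qed
  ultimately show ?thesis
    using sum_multicount_gen[of "UNIV - {0}" "M - {0}" "\<lambda>u f. f u = 0"
        "\<lambda>f. card (left_radical f) - 1"]
    by simp
qed

lemma card_annihilator_mult_card_image:
  assumes "F.subspace M"
  shows "card M = card {f \<in> M. f u = 0} * card ((\<lambda>f. f u) ` M)"
  using F.subspace_diff[OF assms] by (intro card_eq_card_kernel_mult_card_image) auto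

lemma linear_annihilator_image:
  assumes "M \<subseteq> Bil scale" "\<phi> \<in> (\<lambda>f. f u) ` M"
  shows "Vector_Spaces.linear scale (*) \<phi>"
  using assms by (auto simp: Bil_def)

text \<open>Let \<open>Q\<close> and \<open>D\<close> be the cardinalities of \<open>V\<close> and of \<open>N\<close>, and let \<open>N u\<close> be the set of those forms
  in \<open>N\<close> that have \<open>u\<close> in their left radical. If \<open>D > Q\<close>, then \<open>N u\<close> is nontrivial for every \<open>u\<close>,
  and \<open>vanishes_on_radicals_of_pencil\<close>, applied to a nonzero element of \<open>N u\<close>, yields
  \<open>card (N u) \<ge> D * l / Q\<close>. The double count says that the numbers \<open>card (N u) - 1\<close> with \<open>u \<noteq> 0\<close> add
  up to \<open>(D - 1) * (l - 1)\<close>. Together these give \<open>(Q - l) * (D - Q) \<le> 0\<close>, a contradiction.\<close>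

lemma card_constant_rank_le:
  assumes N: "F.subspace N" "N \<subseteq> Bil scale"
    and rad: "\<And>f. f \<in> N \<Longrightarrow> f \<noteq> 0 \<Longrightarrow> card (left_radical f) = l"
    and l: "l < card (UNIV :: 'v set)"
    and large: "card (UNIV :: 'v set) < CARD('a) ^ CARD('a) * l"
  shows "card N \<le> card (UNIV :: 'v set)"
proof (rule ccontr)
  let ?Q = "card (UNIV :: 'v set)" and ?D = "card N"
  let ?N = "\<lambda>u. {f \<in> N. f u = 0}" and ?E = "\<lambda>u. (\<lambda>f. f u) ` N"
  assume gt: "\<not> ?D \<le> ?Q"
  have rad0: "l \<le> card (left_radical f)" if "f \<in> N" for f
  proof (cases "f = 0")
    case True
    then have "left_radical f = UNIV" by (auto simp: left_radical_def)
    then show ?thesis using l by simp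
  qed (use rad that in simp)
  have ineq: "?D * l \<le> card (?N u) * ?Q" for u
  proof -
    have DN: "?D = card (?N u) * card (?E u)" using N(1) by (rule card_annihilator_mult_card_image)
    have "card (?E u) * card {0 :: 'v} \<le> ?Q"
      using linear_annihilator_image[OF N(2)]
      by (intro card_functionals_vanishing_on) (auto dest: N(2)[THEN subsetD] simp: Bil_rules)
    \<comment> \<open>The dual space is too small for \<open>f \<mapsto> f u\<close> to be injective on \<open>N\<close>.\<close>
    then have "card (?N u) \<noteq> 1" using DN gt by auto
    moreover have "0 \<in> ?N u" using F.subspace_0[OF N(1)] by simp
    ultimately have "?N u \<noteq> {0}" by (metis card_1_singleton_iff One_nat_def)
    then obtain f where f: "f \<in> N" "f u = 0" "f \<noteq> 0" using \<open>0 \<in> ?N u\<close> by blast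
    have fB: "f \<in> Bil scale" using f N by auto
    have van: "g u w = 0" if "g \<in> N" "w \<in> right_radical f" for g w
    proof (rule vanishes_on_radicals_of_pencil[OF fB])
      show "g \<in> Bil scale" using that N by auto
      show "card (left_radical f) \<le> card (left_radical (g + form_scale t f))" for t
        using rad[OF f(1,3)] rad0 F.subspace_add[OF N(1) that(1) F.subspace_scale[OF N(1) f(1)]]
        by simp
      show "?Q < CARD('a) ^ CARD('a) * card (left_radical f)" using rad f large by simp
      show "u \<in> left_radical f" using f by (simp add: left_radical_def)
    qed fact
    have "l \<le> card (right_radical f)"
      using card_left_radical_le_card_right_radical[OF fB] rad f by simp
    then have "card (?E u) * l \<le> card (?E u) * card (right_radical f)" by simp
    also have "\<dots> \<le> ?Q"
      using linear_annihilator_image[OF N(2)] van subspace_right_radical[OF fB]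
      by (intro card_functionals_vanishing_on) auto
    finally have "card (?E u) * l \<le> ?Q" .
    then show ?thesis unfolding DN mult.assoc by (rule mult_le_mono2)
  qed
  have "(\<Sum>u\<in>UNIV - {0}. card (?N u) - 1) = (?D - 1) * (l - 1)"
    using sum_card_annihilators[OF N] rad F.subspace_0[OF N(1)]
    by (simp add: card_Diff_singleton)
  moreover have "int (card (?N u) - 1) = int (card (?N u)) - 1" for u
    using F.subspace_0[OF N(1)] by (subst of_nat_diff) (auto simp: Suc_le_eq card_gt_0_iff)
  moreover have D0: "?D \<ge> 1" using gt by simp
  moreover have l0: "l \<ge> 1" using large by (cases l) auto
  ultimately have count: "(\<Sum>u\<in>UNIV - {0 :: 'v}. int (card (?N u)) - 1) = (int ?D - 1) * (int l - 1)"
    by (metis (no_types, lifting) of_nat_1 of_nat_diff of_nat_mult of_nat_sum sum.cong)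
  have Q0: "?Q \<ge> 1" using l by simp
  have "(int ?Q - 1) * (int ?D * int l - int ?Q) = (\<Sum>u\<in>UNIV - {0 :: 'v}. int ?D * int l - int ?Q)"
    using Q0 by (simp add: card_Diff_singleton of_nat_diff)
  also have "\<dots> \<le> (\<Sum>u\<in>UNIV - {0 :: 'v}. int ?Q * (int (card (?N u)) - 1))"
  proof (rule sum_mono)
    fix u
    show "int ?D * int l - int ?Q \<le> int ?Q * (int (card (?N u)) - 1)"
      using ineq[of u, folded of_nat_le_iff[where ?'a = int]] by (simp add: algebra_simps)
  qed
  also have "\<dots> = int ?Q * ((int ?D - 1) * (int l - 1))" by (simp only: sum_distrib_left[symmetric] count)
  finally have "(int ?Q - int l) * (int ?D - int ?Q) \<le> 0" by (simp add: algebra_simps)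
  moreover have "(int ?Q - int l) * (int ?D - int ?Q) > 0" using l gt by simp
  ultimately show False by simp
qed

end

section \<open>Divisibility of exponents\<close>

lemma gcd_power_minus_one:
  fixes q :: nat
  assumes "q > 0" "a > 0"
  shows "gcd (q ^ a - 1) (q ^ b - 1) = q ^ gcd a b - 1"
proof (rule dvd_antisym)
  let ?G = "gcd (q ^ a - 1) (q ^ b - 1)"
  have dvd_mult: "q ^ i - 1 dvd q ^ (i * j) - 1" for i j :: nat
  proof -
    have "int (q ^ i) ^ j - 1 = (int (q ^ i) - 1) * (\<Sum>k<j. int (q ^ i) ^ k)"
      by (rule power_diff_1_eq)
    then have "int (q ^ i) - 1 dvd int (q ^ i) ^ j - 1" by simp
    then have "int (q ^ i - 1) dvd int (q ^ (i * j) - 1)"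
      using assms(1) by (simp add: of_nat_diff power_mult Suc_le_eq)
    then show ?thesis by (simp only: of_nat_dvd_iff)
  qed
  \<comment> \<open>The exponents are chosen so that
    \<open>q ^ (a * x) - 1 = q ^ gcd a b * (q ^ (b * y) - 1) + (q ^ gcd a b - 1)\<close>.\<close>
  obtain x y where xy: "a * x = b * y + gcd a b" using bezout_nat[of a b] assms by auto
  have "?G dvd q ^ (a * x) - 1" by (meson dvd_mult dvd_trans gcd_dvd1)
  moreover have "?G dvd q ^ (b * y) - 1" by (meson dvd_mult dvd_trans gcd_dvd2)
  then have "?G dvd q ^ gcd a b * (q ^ (b * y) - 1)" by simp
  ultimately have "?G dvd (q ^ (a * x) - 1) - q ^ gcd a b * (q ^ (b * y) - 1)"
    by (rule dvd_diff_nat)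
  also have "(q ^ (a * x) - 1) - q ^ gcd a b * (q ^ (b * y) - 1) = q ^ gcd a b - 1"
    using assms(1) by (simp add: xy power_add diff_mult_distrib2 mult.commute)
  finally show "?G dvd q ^ gcd a b - 1" .
  show "q ^ gcd a b - 1 dvd ?G"
  proof (rule gcd_greatest)
    show "q ^ gcd a b - 1 dvd q ^ a - 1" using dvd_mult[of "gcd a b" "a div gcd a b"] by simp
    show "q ^ gcd a b - 1 dvd q ^ b - 1" using dvd_mult[of "gcd a b" "b div gcd a b"] by simp
  qed
qed

text \<open>Write \<open>q ^ d - 1 = A * G\<close> and \<open>q ^ n - 1 = B * G\<close> with \<open>G = q ^ gcd d n - 1\<close> their greatest common
  divisor. Then \<open>A\<close> is coprime to \<open>B\<close> and divides \<open>B\<^sup>2 * G\<close>, so it divides \<open>G\<close>. But if \<open>gcd d n\<close> were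
  a proper divisor of \<open>d\<close>, then \<open>A\<close> would be at least \<open>q ^ gcd d n + 1\<close>, which is larger than \<open>G\<close>.\<close>

lemma dvd_if_power_minus_one_dvd_square:
  fixes q :: nat
  assumes q: "q \<ge> 2" and d: "d > 0" and dvd: "q ^ d - 1 dvd (q ^ n - 1)\<^sup>2"
  shows "d dvd n"
proof -
  define e where "e = gcd d n"
  define G where "G = q ^ e - 1"
  have e: "e > 0" "e dvd d" using d by (auto simp: e_def)
  have "q ^ 1 \<le> q ^ e" using q e by (intro power_increasing) auto
  then have G: "G > 0" using q by (simp add: G_def)
  have gcdG: "gcd (q ^ d - 1) (q ^ n - 1) = G"
    using gcd_power_minus_one[of q d n] q d by (simp add: G_def e_def)
  define A where "A = (q ^ d - 1) div G"
  define B where "B = (q ^ n - 1) div G"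
  have A: "q ^ d - 1 = A * G" and B: "q ^ n - 1 = B * G"
    by (simp_all add: A_def B_def gcdG[symmetric])
  have "coprime A B"
    using div_gcd_coprime[of "q ^ d - 1" "q ^ n - 1"] gcdG G unfolding A_def B_def by force
  have "G * A dvd G * (B\<^sup>2 * G)" using dvd unfolding A B by (simp add: power2_eq_square ac_simps)
  then have "A dvd B\<^sup>2 * G" using G by simp
  then have "A dvd G"
    using \<open>coprime A B\<close> by (simp add: coprime_dvd_mult_right_iff)
  then have "A \<le> G" using G by (rule dvd_imp_le)
  have "d = e"
  proof (rule ccontr)
    assume "d \<noteq> e"
    moreover obtain k where "d = e * k" using e(2) by (rule dvdE)
    ultimately have "2 * e \<le> d" using d by (cases k rule: nat.exhaust; cases "k = 1") auto
    then have "q ^ (2 * e) \<le> q ^ d" using q by (intro power_increasing) auto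
    then have "(q ^ e)\<^sup>2 - 1 \<le> A * G" using A by (simp add: power_mult[symmetric] mult.commute)
    also have "\<dots> \<le> G * G" using \<open>A \<le> G\<close> by simp
    finally have "(G + 1)\<^sup>2 - 1 \<le> G * G" using q by (simp add: G_def)
    then show False using G by (simp add: power2_eq_square)
  qed
  then show ?thesis by (metis e_def gcd_dvd2)
qed

section \<open>Spaces of forms with two ranks\<close>

theorem theorem5:
  fixes scale :: "'a::{field,finite} \<Rightarrow> 'v::ab_group_add \<Rightarrow> 'v"
    and Basis :: "'v set"
    and M :: "('v \<Rightarrow> 'v \<Rightarrow> 'a) set"
    and q n r :: nat
  assumes "q = CARD('a)"
    and "finite_dimensional_vector_space scale Basis"
    and "vector_space.dim scale (UNIV :: 'v set) = n"
    and "M \<subseteq> Bil scale"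
    and "module.subspace form_scale M"
    and "vector_space.dim form_scale M = 2 * n"
    and "0 < r" and "r < n"
    and "\<And>f. f \<in> M \<Longrightarrow> f \<noteq> 0 \<Longrightarrow>
           form_rank scale f = r \<or> form_rank scale f = n"
    and "q \<ge> r + 1"
  shows "(n - r) dvd n \<and>
         real (card {f \<in> M. form_rank scale f = r}) =
           (real q ^ n - 1)\<^sup>2 / (real q ^ (n - r) - 1)"
proof -
  have "finite_field_space scale"
    using assms(2) by (simp add: finite_field_space_def finite_dimensional_vector_space_def)
  moreover have "finite (UNIV :: 'v set)"
    using finite_field_space.finite_span[OF calculation]
      finite_dimensional_vector_space.finite_Basis[OF assms(2)]
      finite_dimensional_vector_space.span_Basis[OF assms(2)] by metis
  ultimately interpret V: finite_vector_space scale
    by (simp add: finite_vector_space_def finite_vector_space_axioms_def)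
  note M = assms(5,4) and rank = assms(9)
  let ?Q = "card (UNIV :: 'v set)" and ?M = "\<lambda>u. {f \<in> M. f u = 0}"
  let ?R = "{f \<in> M. form_rank scale f = r}"
  have q2: "q \<ge> 2" using assms by simp
  have Q: "?Q = q ^ n" using V.card_subspace[of UNIV] assms by simp
  have cM: "card M = q ^ n * q ^ n"
    using V.F.card_subspace[OF M(1)] assms by (simp add: mult_2 power_add)
  have rad: "card (left_radical f) = q ^ V.dim (left_radical f)" if "f \<in> M" for f
    using V.card_subspace[OF subspace_left_radical] that M(2) assms(1) by auto
  have dim_le: "V.dim (left_radical f) \<le> n" if "f \<in> M" for f
  proof -
    have "q ^ V.dim (left_radical f) \<le> q ^ n"
      using card_mono[of UNIV "left_radical f"] rad[OF that] Q by simp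
    then show ?thesis using q2 by simp
  qed
  have rad_r: "card (left_radical f) = q ^ (n - r)" if "f \<in> M" "form_rank scale f = r" for f
  proof -
    have "V.dim (left_radical f) = n - r"
      using dim_le[OF that(1)] that(2) assms(3) by (simp add: form_rank_def)
    then show ?thesis using rad[OF that(1)] by simp
  qed
  have rad_n: "card (left_radical f) = 1" if "f \<in> M" "form_rank scale f = n" for f
  proof -
    have "V.dim (left_radical f) = 0"
      using dim_le[OF that(1)] that(2) assms(3,8) by (simp add: form_rank_def)
    then show ?thesis using rad[OF that(1)] by simp
  qed
  have lQ: "q ^ (n - r) < ?Q" using q2 assms(7,8) unfolding Q by (intro power_strict_increasing) auto
  have large: "?Q < CARD('a) ^ CARD('a) * q ^ (n - r)"
  proof -
    have "?Q < q ^ (q + (n - r))" unfolding Q using q2 assms(8,10) by (intro power_strict_increasing) auto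
    then show ?thesis using assms(1) by (simp add: power_add)
  qed
  \<comment> \<open>The upper bound comes from constant rank, the lower one from the size of the dual space.\<close>
  have cMu: "card (?M u) = q ^ n" if "u \<noteq> 0" for u
  proof (rule antisym)
    have sub: "V.F.subspace (?M u)"
      using M(1) by (auto simp: V.F.subspace_def form_scale_def fun_eq_iff)
    have "card (left_radical f) = q ^ (n - r)" if f: "f \<in> ?M u" "f \<noteq> 0" for f
    proof -
      have "{0, u} \<subseteq> left_radical f"
        using f M(2) by (auto simp: left_radical_def V.Bil_rules)
      then have "card {0, u} \<le> card (left_radical f)" by (intro card_mono) auto
      then have "form_rank scale f \<noteq> n" using rad_n f \<open>u \<noteq> 0\<close> by auto
      then show ?thesis using rank rad_r f by auto
    qed
    then show "card (?M u) \<le> q ^ n"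
      using V.card_constant_rank_le[OF sub _ _ lQ large] M(2) Q by auto
    have "card ((\<lambda>f. f u) ` M) * card {0 :: 'v} \<le> ?Q"
      using V.linear_annihilator_image[OF M(2)] M(2)
      by (intro V.card_functionals_vanishing_on) (auto simp: V.Bil_rules)
    then have "card ((\<lambda>f. f u) ` M) \<le> q ^ n" using Q by simp
    then have "card (?M u) * card ((\<lambda>f. f u) ` M) \<le> card (?M u) * q ^ n" by (rule mult_le_mono2)
    then have "q ^ n * q ^ n \<le> card (?M u) * q ^ n"
      unfolding cM[symmetric] V.card_annihilator_mult_card_image[OF M(1), of u] .
    then show "q ^ n \<le> card (?M u)" using q2 by simp
  qed
  have "(\<Sum>u\<in>UNIV - {0 :: 'v}. card (?M u) - 1) = (q ^ n - 1) * (q ^ n - 1)"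
    using Q by (simp add: cMu card_Diff_singleton)
  moreover have "(\<Sum>f\<in>M - {0}. card (left_radical f) - 1) = card ?R * (q ^ (n - r) - 1)"
  proof -
    have "form_rank scale 0 \<noteq> r"
      using assms(7) by (simp add: form_rank_def left_radical_def)
    then have sub: "?R \<subseteq> M - {0}" by auto
    have "card (left_radical f) - 1 = 0" if "f \<in> (M - {0}) - ?R" for f
      using that rank[of f] rad_n[of f] by auto
    then have "(\<Sum>f\<in>M - {0}. card (left_radical f) - 1) = (\<Sum>f\<in>?R. card (left_radical f) - 1)"
      using sub by (intro sum.mono_neutral_right) auto
    then show ?thesis using rad_r by simp
  qed
  ultimately have count: "(q ^ n - 1)\<^sup>2 = card ?R * (q ^ (n - r) - 1)"
    using V.sum_card_annihilators[OF M] by (simp add: power2_eq_square)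
  then have "q ^ (n - r) - 1 dvd (q ^ n - 1)\<^sup>2" by (simp only: dvd_triv_right)
  then have "(n - r) dvd n"
    using dvd_if_power_minus_one_dvd_square[OF q2, of "n - r" n] assms(8) by simp
  moreover have "(real q ^ n - 1)\<^sup>2 = real (card ?R) * (real q ^ (n - r) - 1)"
    using arg_cong[OF count, of real] q2 by (simp add: of_nat_diff Suc_le_eq)
  moreover have "real q ^ (n - r) > 1" using q2 assms(8) by (intro one_less_power) auto
  ultimately show ?thesis by simp
qed

end
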